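(* The Steiner-Soddy family of polygons $P$ conserves the sum of powers of half-angle tangents, up to power $N-1$: for each $k=1,\dots,N-1$, the sum $$\sum_{i=1}^N\tan^k\frac{\theta_i}{2}$$ is constant over the family, where $\theta_i$ is the internal angle of $P$ at its $i$-th vertex $P_i$.
   Context: Consider $N$ congruent circles centered at the vertices of a regular $N$-gon, consecutive ones being tangent. By symmetry, all of them are tangent to an inner circle and to an outer circle. The image of this configuration under inversion in a fixed circle is a Steiner chain: $N$ circles, consecutive ones tangent, all tangent to two fixed circles (the inner and outer Soddy circles, images of the two concentric circles). Rotating the regular $N$-gon about its center, with the inversion circle fixed, gives a one-parameter family of such chains with the same Soddy circles, called the Steiner porism. The Steiner-Soddy polygon $P$ is the $N$-gon whose consecutive vertices $P_1,\dots,P_N$ are the centers of the consecutive circles in the chain; the Steiner-Soddy family is the family of these polygons over the Steiner porism. All polygons of the family are inscribed in one fixed conic $E$ (an ellipse, a hyperbola, or a parabola), and their sides are tangent to one fixed circle. Sign convention: when $E$ is a hyperbola, the sign of $\tan(\theta_i/2)$ must be flipped for the two angles whose neighboring vertices lie on different branches of the hyperbola.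
   Formalization: If P has vertices on both branches of E, angles are taken between rays to the sides' contact points on the fixed circle, on a fixed side of P (possibly reflex): at the two sign-flipped vertices the supplement replaces the Euclidean angle, for which the claim fails. Collinear P is excluded. *)

theory Defs
  imports "HOL-Analysis.Analysis"
begin

text \<open>
  The plane is \<^typ>\<open>complex\<close>. Parameters throughout: the number \<open>N\<close> of circles; centre \<open>c\<close> and
  circumradius \<open>R\<close> of the regular \<open>N\<close>-gon; centre \<open>p\<close> and radius \<open>\<rho>\<close> of the inversion circle;
  rotation angle \<open>t\<close>. Indices are integers, and everything is periodic in the index with
  period \<open>N\<close>, so \<open>j - 1\<close> and \<open>j + 1\<close> always denote the cyclic neighbours of \<open>j\<close>.
\<close>

definition regular_vertex :: "nat \<Rightarrow> complex \<Rightarrow> real \<Rightarrow> real \<Rightarrow> int \<Rightarrow> complex" where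
  "regular_vertex N c R t j = c + of_real R * cis (t + 2 * pi * of_int j / of_nat N)"

text \<open>The radius is half the side length of the regular polygon, so neighbours are tangent.\<close>

definition base_circle :: "nat \<Rightarrow> complex \<Rightarrow> real \<Rightarrow> real \<Rightarrow> int \<Rightarrow> complex set" where
  "base_circle N c R t j = sphere (regular_vertex N c R t j) (R * sin (pi / of_nat N))"

text \<open>The value at \<open>p\<close> itself is irrelevant: it is only applied to circles avoiding \<open>p\<close>.\<close>

definition inversion :: "complex \<Rightarrow> real \<Rightarrow> complex \<Rightarrow> complex" where
  "inversion p \<rho> z = p + of_real (\<rho>\<^sup>2) / cnj (z - p)"

definition chain_circle ::
  "nat \<Rightarrow> complex \<Rightarrow> real \<Rightarrow> complex \<Rightarrow> real \<Rightarrow> real \<Rightarrow> int \<Rightarrow> complex set" where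
  "chain_circle N c R p \<rho> t j = inversion p \<rho> ` base_circle N c R t j"

text \<open>
  The rotation angles for which the image is a chain of circles: a base circle through \<open>p\<close>
  would be mapped to a line, and the corresponding vertex would be at infinity.
\<close>

definition steiner_porism :: "nat \<Rightarrow> complex \<Rightarrow> real \<Rightarrow> complex \<Rightarrow> real set" where
  "steiner_porism N c R p = {t. \<forall>j. p \<notin> base_circle N c R t j}"

definition circle_centre :: "complex set \<Rightarrow> complex" where
  "circle_centre S = (THE m. \<exists>s>0. S = sphere m s)"

definition soddy_vertex ::
  "nat \<Rightarrow> complex \<Rightarrow> real \<Rightarrow> complex \<Rightarrow> real \<Rightarrow> real \<Rightarrow> int \<Rightarrow> complex" where
  "soddy_vertex N c R p \<rho> t j = circle_centre (chain_circle N c R p \<rho> t j)"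

text \<open>
  The point where the consecutive chain circles \<open>j\<close> and \<open>j + 1\<close> touch. It is also the point
  where the side line through the vertices \<open>j\<close> and \<open>j + 1\<close> touches the fixed circle to which
  all sides are tangent: that circle is the image of the circle of radius \<open>R cos (\<pi>/N)\<close>
  about \<open>c\<close>, which is orthogonal to all base circles at their contact points.
\<close>

definition contact_point ::
  "nat \<Rightarrow> complex \<Rightarrow> real \<Rightarrow> complex \<Rightarrow> real \<Rightarrow> real \<Rightarrow> int \<Rightarrow> complex" where
  "contact_point N c R p \<rho> t j =
     (THE z. z \<in> chain_circle N c R p \<rho> t j \<inter> chain_circle N c R p \<rho> t (j + 1))"

text \<open>
  Orientation of the family, the same for all \<open>t\<close>: the order in which the contact points follow
  each other on the fixed circle tangent to the sides. The base contact points run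
  counterclockwise, and inversion preserves the sense on a circle iff \<open>p\<close> lies inside it.
\<close>

definition family_orientation :: "nat \<Rightarrow> complex \<Rightarrow> real \<Rightarrow> complex \<Rightarrow> real" where
  "family_orientation N c R p = (if dist p c < R * cos (pi / of_nat N) then 1 else -1)"

text \<open>Whether the polygon turns at vertex \<open>j\<close> towards the inner side given by the orientation.\<close>

definition inward_turn ::
  "nat \<Rightarrow> complex \<Rightarrow> real \<Rightarrow> complex \<Rightarrow> real \<Rightarrow> real \<Rightarrow> int \<Rightarrow> bool" where
  "inward_turn N c R p \<rho> t j \<longleftrightarrow>
     (let P = soddy_vertex N c R p \<rho> t
      in 0 < family_orientation N c R p * Im ((P (j + 1) - P j) * cnj (P j - P (j - 1))))"

text \<open>
  The angle in \<open>[0, \<pi>]\<close> between the two sides meeting at vertex \<open>j\<close>, measured between the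
  rays from the vertex to the points where the side lines touch the fixed circle. These are the
  rays to the two neighbouring vertices, except when exactly one neighbour of \<open>j\<close> lies on the
  other branch of a hyperbola. Then the line to that neighbour touches the fixed circle on the
  opposite ray: the part of that line carrying the contact point joins the two branches through
  infinity, and it is that part that counts as the side, so that the angle is the supplement of
  the one subtended by the neighbours. (With the latter the sums are not constant, whatever the
  signs.)
\<close>

definition side_angle ::
  "nat \<Rightarrow> complex \<Rightarrow> real \<Rightarrow> complex \<Rightarrow> real \<Rightarrow> real \<Rightarrow> int \<Rightarrow> real" where
  "side_angle N c R p \<rho> t j =
     (let P = soddy_vertex N c R p \<rho> t j; T = contact_point N c R p \<rho> t
      in \<bar>Arg ((T (j - 1) - P) / (T j - P))\<bar>)"

text \<open>Internal angle in \<open>[0, 2\<pi>]\<close>, measured on the inner side, hence reflex at an outward turn.\<close>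

definition internal_angle ::
  "nat \<Rightarrow> complex \<Rightarrow> real \<Rightarrow> complex \<Rightarrow> real \<Rightarrow> real \<Rightarrow> int \<Rightarrow> real" where
  "internal_angle N c R p \<rho> t j =
     (if inward_turn N c R p \<rho> t j then side_angle N c R p \<rho> t j
      else 2 * pi - side_angle N c R p \<rho> t j)"

definition hyperbola_branch :: "complex \<Rightarrow> complex \<Rightarrow> real \<Rightarrow> complex set" where
  "hyperbola_branch F G a = {z. dist z F - dist z G = 2 * a}"

definition hyperbola :: "complex \<Rightarrow> complex \<Rightarrow> real \<Rightarrow> complex set" where
  "hyperbola F G a = hyperbola_branch F G a \<union> hyperbola_branch G F a"

text \<open>
  The conic through all vertices of the whole family is a hyperbola, and the neighbours of
  vertex \<open>j\<close> lie on different branches of it. Exchanging \<open>F\<close> and \<open>G\<close> exchanges the branches.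
\<close>

definition neighbours_on_different_branches ::
  "nat \<Rightarrow> complex \<Rightarrow> real \<Rightarrow> complex \<Rightarrow> real \<Rightarrow> real \<Rightarrow> int \<Rightarrow> bool" where
  "neighbours_on_different_branches N c R p \<rho> t j \<longleftrightarrow>
     (\<exists>F G a. 0 < a \<and> 2 * a < dist F G
        \<and> (\<forall>s\<in>steiner_porism N c R p. \<forall>i. soddy_vertex N c R p \<rho> s i \<in> hyperbola F G a)
        \<and> soddy_vertex N c R p \<rho> t (j - 1) \<in> hyperbola_branch F G a
        \<and> soddy_vertex N c R p \<rho> t (j + 1) \<in> hyperbola_branch G F a)"

definition half_angle_tangent ::
  "nat \<Rightarrow> complex \<Rightarrow> real \<Rightarrow> complex \<Rightarrow> real \<Rightarrow> real \<Rightarrow> int \<Rightarrow> real" where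
  "half_angle_tangent N c R p \<rho> t j =
     (if neighbours_on_different_branches N c R p \<rho> t j
      then - tan (internal_angle N c R p \<rho> t j / 2)
      else tan (internal_angle N c R p \<rho> t j / 2))"

end

theory Submission
  imports Defs
begin

text \<open>
  Let \<open>d\<close> be the distance from \<open>p\<close> to \<open>c\<close>, and let \<open>m = R cos (\<pi>/N)\<close> and \<open>r = R sin (\<pi>/N)\<close> be the
  radii of the circle through the base contact points and of the base circles. The power of
  \<open>p\<close> with respect to the base circle at angle \<open>\<phi>\<close> is
  \<open>D \<phi> = d\<^sup>2 + m\<^sup>2 - 2 R d cos (\<phi> - \<phi>\<^sub>0)\<close>. The whole theorem rests on the identity
  \<open>half_angle_tangent = m / (r \<bar>m\<^sup>2 - d\<^sup>2\<bar>) * D\<close> (\<open>half_angle_tangent_eq\<close>): up to a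
  factor common to the whole family, the half-angle tangents are values of an affine function of
  the cosine at \<open>N\<close> equally spaced angles. Their \<open>k\<close>-th powers are trigonometric polynomials of degree
  \<open>k < N\<close>, of which the sum over equally spaced points retains only the constant term
  (\<open>circle_power_sum_constant\<close>).

  The absolute value in the identity is elementary: the side lines touch the image of the circle of
  radius \<open>m\<close>, which has radius \<open>\<rho>\<^sup>2 m / \<bar>m\<^sup>2 - d\<^sup>2\<bar>\<close>, and the tangent length from a vertex is the
  radius \<open>\<rho>\<^sup>2 r / \<bar>D\<bar>\<close> of its chain circle. The quotient of these two lengths is the tangent of half
  the angle between the sides. It is computed with unit vectors along the sides, for which
  the vertices have simple coordinates (\<open>centre_minus_contact\<close>, \<open>side_direction_quotient\<close>).

  The sign needs two facts. A side vector is a positive multiple of the unit vector times the sign of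
  \<open>D\<^sub>j D\<^sub>j\<^sub>+\<^sub>1\<close>, so the polygon turns inward at vertex \<open>j\<close> iff
  \<open>D\<^sub>j\<^sub>-\<^sub>1 D\<^sub>j D\<^sub>j\<^sub>+\<^sub>1 > 0\<close> (\<open>inward_turn_iff\<close>). And the neighbours of vertex \<open>j\<close> lie on different
  branches of the conic iff \<open>D\<^sub>j\<^sub>-\<^sub>1 D\<^sub>j\<^sub>+\<^sub>1 < 0\<close> (\<open>neighbours_on_different_branches_iff\<close>). The
  product of the two signs is the sign of \<open>D\<^sub>j\<close>. For the second fact, if \<open>D\<close> takes
  negative values, then the Soddy centres are foci of a hyperbola whose branches are told apart by the
  sign of \<open>D\<close>. Conversely, on any hyperbola through the whole family, vertices with the same sign of
  \<open>D\<close> are joined by a connected arc of centres, hence lie on one branch.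
\<close>

section \<open>Inversion, spheres and contact points\<close>

lemma inversion_inversion:
  assumes "z \<noteq> p" "\<rho> > 0"
  shows "inversion p \<rho> (inversion p \<rho> z) = z"
  using assms by (simp add: inversion_def)

text \<open>
  With \<open>y = z - p\<close> and \<open>w = v - p\<close>, the sphere is the locus \<open>\<bar>y\<bar>\<^sup>2 - 2 y \<bullet> w + D = 0\<close>, where \<open>D\<close> is
  the power of \<open>p\<close>. Dividing by \<open>\<bar>y\<bar>\<^sup>2\<close> turns this into an equation of the same shape for the
  inverted point.
\<close>

lemma inversion_mem_sphere:
  fixes p v z :: complex and r \<rho> :: real
  defines "D \<equiv> (cmod (v - p))\<^sup>2 - r\<^sup>2"
  assumes "z \<in> sphere v r" "p \<notin> sphere v r" "r > 0"
  shows "inversion p \<rho> z \<in> sphere (p + of_real (\<rho>\<^sup>2) * (v - p) / of_real D) (\<rho>\<^sup>2 * r / \<bar>D\<bar>)"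
proof -
  define y where "y = z - p"
  define w where "w = v - p"
  have D: "D \<noteq> 0"
    using assms(3,4) by (simp add: D_def dist_norm power2_eq_iff_nonneg)
  have y: "y \<noteq> 0" using assms by (auto simp: y_def)
  have "(cmod (y - w))\<^sup>2 = r\<^sup>2"
    using assms(2) by (simp add: y_def w_def dist_norm norm_minus_commute)
  hence "(y - w) * cnj (y - w) = of_real (r\<^sup>2)"
    using complex_norm_square[of "y - w"] by simp
  hence 1: "y * cnj y - y * cnj w - w * cnj y + of_real D = 0"
    unfolding D_def of_real_diff w_def[symmetric] complex_norm_square
    by (simp add: algebra_simps)
  have D2: "w * cnj w = of_real D + of_real (r\<^sup>2)"
    unfolding D_def of_real_diff w_def[symmetric] complex_norm_square by simp
  define A where "A = of_real (\<rho>\<^sup>2) / cnj y - of_real (\<rho>\<^sup>2) * w / complex_of_real D"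
  have A: "A = of_real (\<rho>\<^sup>2) * (of_real D - w * cnj y) / (cnj y * of_real D)"
    using y D by (simp add: A_def field_simps)
  have "A * cnj A = (of_real (\<rho>\<^sup>2))\<^sup>2 * ((of_real D - w * cnj y) * (of_real D - cnj w * y)) / (y * cnj y * of_real D ^ 2)"
    unfolding A by (simp add: power2_eq_square mult_ac)
  also have "(of_real D - w * cnj y) * (of_real D - cnj w * y) = y * cnj y * of_real (r\<^sup>2)"
  proof -
    have "w * cnj y + cnj w * y = y * cnj y + of_real D" using 1 by (simp add: algebra_simps)
    moreover have "(of_real D - w * cnj y) * (of_real D - cnj w * y) = of_real D * (of_real D - (w * cnj y + cnj w * y)) + w * cnj w * (y * cnj y)"
      by (simp add: algebra_simps)
    ultimately show ?thesis unfolding D2 by (simp add: algebra_simps)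
  qed
  also have "(of_real (\<rho>\<^sup>2))\<^sup>2 * (y * cnj y * of_real (r\<^sup>2)) / (y * cnj y * of_real D ^ 2) = of_real ((\<rho>\<^sup>2 * r / \<bar>D\<bar>)\<^sup>2)"
    using y by (simp add: field_simps)
  finally have "(cmod A)\<^sup>2 = (\<rho>\<^sup>2 * r / \<bar>D\<bar>)\<^sup>2"
    unfolding complex_norm_square[symmetric] of_real_eq_iff .
  hence "cmod A = \<rho>\<^sup>2 * r / \<bar>D\<bar>"
    using \<open>r > 0\<close> by (simp add: power2_eq_iff_nonneg)
  thus ?thesis
    by (simp add: inversion_def A_def y_def w_def dist_norm norm_minus_commute)
qed

text \<open>
  The reverse inclusion comes from applying the previous lemma to the image sphere: inversion is an
  involution and leads back to the original centre and radius.
\<close>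

lemma inversion_image_sphere:
  fixes p v :: complex and r \<rho> :: real
  defines "D \<equiv> (cmod (v - p))\<^sup>2 - r\<^sup>2"
  assumes "p \<notin> sphere v r" "r > 0" "\<rho> > 0"
  shows "inversion p \<rho> ` sphere v r = sphere (p + of_real (\<rho>\<^sup>2) * (v - p) / of_real D) (\<rho>\<^sup>2 * r / \<bar>D\<bar>)"
    (is "_ = sphere ?v' ?r'")
proof
  show "inversion p \<rho> ` sphere v r \<subseteq> sphere ?v' ?r'"
    using inversion_mem_sphere[of _ v r p \<rho>] assms by auto
next
  have D: "D \<noteq> 0"
    using assms by (simp add: D_def dist_norm power2_eq_iff_nonneg)
  define D' where "D' = (cmod (?v' - p))\<^sup>2 - ?r'\<^sup>2"
  have "cmod (?v' - p) = \<rho>\<^sup>2 * cmod (v - p) / \<bar>D\<bar>"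
    by (simp only: add_diff_cancel_left' norm_divide norm_mult norm_of_real) simp
  hence "D' = \<rho>^4 * ((cmod (v-p))\<^sup>2 - r\<^sup>2) / D\<^sup>2"
    by (simp add: D'_def power_mult_distrib power_divide diff_divide_distrib[symmetric] right_diff_distrib
        flip: power_mult)
  hence D': "D' = \<rho>^4 / D" using D by (simp only: D_def[symmetric]) (simp add: power2_eq_square)
  have r': "?r' > 0" using assms D by simp
  have "D' \<noteq> 0" using D' D \<open>\<rho> > 0\<close> by simp
  hence p': "p \<notin> sphere ?v' ?r'"
    by (auto simp: D'_def dist_norm norm_minus_commute)
  show "sphere ?v' ?r' \<subseteq> inversion p \<rho> ` sphere v r"
  proof
    fix z assume z: "z \<in> sphere ?v' ?r'"
    have "inversion p \<rho> z \<in> sphere (p + of_real (\<rho>\<^sup>2) * (?v' - p) / of_real D') (\<rho>\<^sup>2 * ?r' / \<bar>D'\<bar>)"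
      unfolding D'_def using inversion_mem_sphere[OF z p' r'] .
    also have "p + of_real (\<rho>\<^sup>2) * (?v' - p) / of_real D' = v"
      using D \<open>\<rho> > 0\<close> by (simp add: D' field_simps power4_eq_xxxx power2_eq_square)
    also have "\<rho>\<^sup>2 * ?r' / \<bar>D'\<bar> = r"
      using D \<open>\<rho> > 0\<close> by (simp add: D' abs_mult abs_divide field_simps power4_eq_xxxx power2_eq_square)
    finally have "inversion p \<rho> z \<in> sphere v r" .
    moreover have "z \<noteq> p" using z p' by blast
    ultimately show "z \<in> inversion p \<rho> ` sphere v r"
      using inversion_inversion[OF _ \<open>\<rho> > 0\<close>, of z p] by force
  qed
qed

lemma sphere_centre_unique:
  fixes m m' :: complex
  assumes "sphere m s = sphere m' s'" "s > 0" "s' > 0"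
  shows "m = m'"
proof -
  \<comment> \<open>The parallelogram law for two antipodal points of the sphere about \<open>a\<close>.\<close>
  have *: "(cmod (a - b))\<^sup>2 + x\<^sup>2 = y\<^sup>2" if "sphere a x \<subseteq> sphere b y" "x > 0" for a b :: complex and x y
  proof -
    have "a + of_real x \<in> sphere b y" "a - of_real x \<in> sphere b y"
      using that(2) by (intro subsetD[OF that(1)]; simp add: dist_norm)+
    hence "cmod (a + of_real x - b) = y" "cmod (a - of_real x - b) = y"
      by (metis mem_sphere dist_norm norm_minus_commute)+
    hence "cmod (a - b + of_real x) = y" "cmod (a - b - of_real x) = y"
      by (simp_all add: algebra_simps)
    hence "(cmod (a - b + of_real x))\<^sup>2 + (cmod (a - b - of_real x))\<^sup>2 = 2 * y\<^sup>2" by simp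
    thus ?thesis by (simp only: cmod_power2) (simp add: power2_eq_square algebra_simps)
  qed
  \<comment> \<open>By symmetry the difference of the squared radii is both plus and minus the squared distance of the centres.\<close>
  have "(cmod (m - m'))\<^sup>2 + (cmod (m' - m))\<^sup>2 = 0"
    using *[OF equalityD1[OF assms(1)] assms(2)] *[OF equalityD2[OF assms(1)] assms(3)]
    by linarith
  hence "cmod (m - m') = 0" by (simp only: sum_power2_eq_zero_iff)
  thus ?thesis by simp
qed

lemma circle_centre_sphere:
  assumes "s > 0" shows "circle_centre (sphere m s) = m"
  unfolding circle_centre_def using assms sphere_centre_unique by (intro the_equality) blast+

lemma tangent_spheres_midpoint:
  fixes v v' z :: complex
  assumes "dist v v' = 2 * r"
  shows "z \<in> sphere v r \<inter> sphere v' r \<longleftrightarrow> z = midpoint v v'"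
proof
  assume "z \<in> sphere v r \<inter> sphere v' r"
  hence "(cmod (z - v))\<^sup>2 = r\<^sup>2" "(cmod (z - v'))\<^sup>2 = r\<^sup>2"
    by (auto simp: dist_norm norm_minus_commute)
  moreover have "(cmod (v - v'))\<^sup>2 = 4 * r\<^sup>2"
    using assms by (simp add: dist_norm power2_eq_square)
  moreover have "(cmod (2 * z - (v + v')))\<^sup>2 = 2 * (cmod (z - v))\<^sup>2 + 2 * (cmod (z - v'))\<^sup>2 - (cmod (v - v'))\<^sup>2"
    unfolding cmod_power2 by (simp add: power2_eq_square algebra_simps)
  ultimately have "2 * z = v + v'" by simp
  thus "z = midpoint v v'" by (simp add: midpoint_def scaleR_conv_of_real field_simps)
next
  assume "z = midpoint v v'"
  thus "z \<in> sphere v r \<inter> sphere v' r"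
    using assms by (simp add: dist_midpoint)
qed

section \<open>Trigonometry\<close>

lemma cis_double_arctan: "cis (2 * arctan w) = (1 + \<i> * of_real w)\<^sup>2 / of_real (1 + w\<^sup>2)"
proof -
  have "1 + w\<^sup>2 > 0" by (simp add: add_pos_nonneg)
  have "cis (arctan w) = (1 + \<i> * of_real w) / of_real (sqrt (1 + w\<^sup>2))"
    by (simp add: complex_eq_iff cos_arctan sin_arctan Re_divide_of_real Im_divide_of_real)
  hence "cis (arctan w) ^ 2 = (1 + \<i> * of_real w)\<^sup>2 / of_real (sqrt (1 + w\<^sup>2) ^ 2)"
    by (simp only: power_divide of_real_power)
  thus ?thesis using \<open>1 + w\<^sup>2 > 0\<close> by (simp only: Complex.DeMoivre real_sqrt_pow2 less_imp_le) simp
qed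

text \<open>
  The square of \<open>1 + \<i> w\<close> has argument \<open>2 arctan w\<close>, which lies strictly between \<open>-\<pi>\<close> and \<open>\<pi>\<close>
  and is therefore the principal one.
\<close>

lemma tan_half_abs_Arg:
  fixes w a :: real and z :: complex
  assumes "z = of_real a * (1 + \<i> * of_real w)\<^sup>2" "a > 0"
  shows "tan (\<bar>Arg z\<bar> / 2) = \<bar>w\<bar>"
proof -
  have "1 + w\<^sup>2 > 0" by (simp add: add_pos_nonneg)
  hence "z = of_real (a * (1 + w\<^sup>2)) * cis (2 * arctan w)"
    unfolding assms(1) cis_double_arctan of_real_mult by (simp del: of_real_add of_real_power)
  hence "Arg z = 2 * arctan w"
    using arctan_bounded[of w] assms(2) \<open>1 + w\<^sup>2 > 0\<close>
    by (intro Arg_unique[of "a * (1 + w\<^sup>2)"]) (auto simp: cis_conv_exp mult_ac)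
  hence "\<bar>Arg z\<bar> / 2 = \<bar>arctan w\<bar>" by simp
  thus ?thesis by (cases "w \<ge> 0") (auto simp: abs_if tan_minus tan_arctan)
qed

lemma sum_cyclic_shift:
  fixes g :: "int \<Rightarrow> 'a::comm_monoid_add"
  assumes "g (int N + 1) = g 1"
  shows "(\<Sum>j\<in>{1..int N}. g (j + 1)) = (\<Sum>j\<in>{1..int N}. g j)"
proof (cases "N = 0")
  case False
  have "(\<Sum>j\<in>{1..int N}. g (j + 1)) = (\<Sum>j\<in>{2..int N + 1}. g j)"
    by (rule sum.reindex_bij_witness[of _ "\<lambda>j. j - 1" "\<lambda>j. j + 1"]) auto
  also have "{2..int N + 1} = insert (int N + 1) {2..int N}" using False by auto
  also have "sum g \<dots> = sum g (insert 1 {2..int N})" using assms by simp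
  also have "insert 1 {2..int N} = {1..int N}" using False by auto
  finally show ?thesis .
qed simp

text \<open>
  A cyclic shift of the index multiplies the sum by a root of unity other than 1.
\<close>

lemma sum_cis_equidistributed:
  fixes n :: int
  assumes "n \<noteq> 0" "\<bar>n\<bar> < int N"
  shows "(\<Sum>j\<in>{1..int N}. cis (of_int n * (t + 2 * pi * of_int j / of_nat N))) = 0"
proof -
  define g where "g j = cis (of_int n * (t + 2 * pi * of_int j / of_nat N))" for j :: int
  define w where "w = cis (2 * pi * of_int n / of_nat N)"
  have N: "N > 0" using assms by auto
  have step: "g (j + 1) = w * g j" for j
    unfolding g_def w_def cis_mult using N by (intro arg_cong[of _ _ cis]) (simp add: field_simps)
  have "g (int N + 1) = g 1 * cis (2 * pi * of_int n)"
    unfolding g_def cis_mult using N by (intro arg_cong[of _ _ cis]) (simp add: field_simps)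
  hence "(\<Sum>j\<in>{1..int N}. g (j + 1)) = (\<Sum>j\<in>{1..int N}. g j)"
    by (intro sum_cyclic_shift) (simp add: cis_multiple_2pi)
  hence "(w - 1) * (\<Sum>j\<in>{1..int N}. g j) = 0"
    by (simp add: step left_diff_distrib flip: sum_distrib_left)
  moreover have "w \<noteq> 1"
  proof
    assume "w = 1"
    hence "cos (2 * pi * of_int n / of_nat N) = 1"
      by (simp add: w_def complex_eq_iff)
    then obtain i :: int where "2 * pi * of_int n / of_nat N = of_int i * 2 * pi"
      by (auto simp: cos_one_2pi_int)
    hence "real_of_int n = of_int (i * int N)" using N by (simp add: field_simps)
    hence "n = i * int N" by (simp only: of_int_eq_iff)
    hence "int N dvd n" by simp
    thus False using assms by (meson dvd_imp_le_int not_le abs_of_nat zdvd_not_zless zero_less_abs_iff abs_dvd_iff dvd_abs_iff)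
  qed
  ultimately show ?thesis by (simp add: g_def)
qed

text \<open>
  The extra character \<open>n\<close> makes the induction work: one factor \<open>a + b cis x + b' cnj (cis x)\<close> is
  traded for a shift of \<open>n\<close> by at most one, so \<open>k + \<bar>n\<bar>\<close> does not grow. At \<open>k = 0\<close> every
  character left is either trivial or sums to zero.
\<close>

lemma power_sum_cis_constant:
  fixes a b b' :: complex and n :: int and N k :: nat
  defines "x \<equiv> \<lambda>t j. t + 2 * pi * of_int j / of_nat N"
  assumes "int k + \<bar>n\<bar> < int N"
  shows "(\<Sum>j\<in>{1..int N}. (a + b * cis (x t j) + b' * cnj (cis (x t j))) ^ k * cis (of_int n * x t j)) =
    (\<Sum>j\<in>{1..int N}. (a + b * cis (x s j) + b' * cnj (cis (x s j))) ^ k * cis (of_int n * x s j))"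
  using assms(2)
proof (induction k arbitrary: n)
  case 0
  thus ?case by (cases "n = 0") (simp_all add: x_def sum_cis_equidistributed)
next
  case (Suc k)
  define S where "S n t = (\<Sum>j\<in>{1..int N}. (a + b * cis (x t j) + b' * cnj (cis (x t j))) ^ k * cis (of_int n * x t j))"
    for n :: int and t
  have "(\<Sum>j\<in>{1..int N}. (a + b * cis (x t j) + b' * cnj (cis (x t j))) ^ Suc k * cis (of_int n * x t j)) =
      a * S n t + b * S (n + 1) t + b' * S (n - 1) t" for t
  proof -
    have 1: "cis (of_int (n + 1) * y) = cis y * cis (of_int n * y)"
      and 2: "cis (of_int (n - 1) * y) = cnj (cis y) * cis (of_int n * y)" for y
      by (simp_all add: cis_mult cis_cnj algebra_simps)
    show ?thesis
      unfolding S_def 1 2 sum_distrib_left sum.distrib[symmetric]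
      by (intro sum.cong) (simp_all add: algebra_simps)
  qed
  moreover have "S i t = S i s" if "\<bar>i\<bar> \<le> \<bar>n\<bar> + 1" for i
    unfolding S_def using Suc.prems that by (intro Suc.IH) simp
  ultimately show ?case by simp
qed

lemma countable_cos_eq: "countable {x :: real. cos x = K}"
proof (cases "\<exists>y. cos y = K")
  case True
  then obtain y where y: "K = cos y" by blast
  have "{x. cos x = K} \<subseteq> (\<lambda>n::int. y + 2 * of_int n * pi) ` UNIV \<union> (\<lambda>n::int. - y + 2 * of_int n * pi) ` UNIV"
    unfolding y cos_eq by (auto elim!: Ints_cases)
  thus ?thesis by (rule countable_subset) auto
qed auto

text \<open>
  On a circle, one of the two arcs between two points avoids the point where the cosine is largest;
  lifting the points to \<open>[0, 2\<pi>]\<close>, on which the cosine first falls and then rises, selects that arc.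
\<close>

lemma cos_arc_maximum:
  "\<exists>x' y'. cis x' = cis x \<and> cis y' = cis y \<and>
     (\<forall>z\<in>closed_segment x' y'. cos (z - \<alpha>) \<le> max (cos (x - \<alpha>)) (cos (y - \<alpha>)))"
proof -
  have reduce: "\<exists>u'. 0 \<le> u' \<and> u' \<le> 2 * pi \<and> cis u' = cis u" for u
    using sincos_total_2pi[of "cos u" "sin u"]
    by (metis sin_cos_squared_add3 power2_eq_square add.commute complex_eq_iff cis.sel less_imp_le sin_cos_squared_add)
  obtain u where u: "0 \<le> u" "u \<le> 2 * pi" "cis u = cis (x - \<alpha>)" using reduce by blast
  obtain v where v: "0 \<le> v" "v \<le> 2 * pi" "cis v = cis (y - \<alpha>)" using reduce by blast
  have cu: "cos u = cos (x - \<alpha>)" and cv: "cos v = cos (y - \<alpha>)"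
    using u(3) v(3) by (simp_all add: complex_eq_iff)
  have bound: "cos z \<le> max (cos a) (cos b)" if "0 \<le> a" "a \<le> z" "z \<le> b" "b \<le> 2 * pi" for a b z :: real
  proof (cases "z \<le> pi")
    case True
    hence "cos z \<le> cos a" using that by (intro cos_monotone_0_pi_le) auto
    thus ?thesis by simp
  next
    case False
    hence "cos (2 * pi - z) \<le> cos (2 * pi - b)" using that by (intro cos_monotone_0_pi_le) auto
    thus ?thesis by (simp add: cos_diff)
  qed
  have "cos (z - \<alpha>) \<le> max (cos u) (cos v)" if "z \<in> closed_segment (\<alpha> + u) (\<alpha> + v)" for z
    using that bound[of u "z - \<alpha>" v] bound[of v "z - \<alpha>" u] u v
    by (auto simp: closed_segment_eq_real_ivl max.commute split: if_splits)
  moreover have "cis (\<alpha> + u) = cis x" "cis (\<alpha> + v) = cis y"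
    using u(3) v(3) by (simp_all add: cis_mult flip: cis_mult[of \<alpha> u] cis_mult[of \<alpha> v])
  ultimately show ?thesis unfolding cu cv by blast
qed

section \<open>Coordinates for the Steiner chain\<close>

locale steiner_configuration =
  fixes N :: nat and c p :: complex and R \<rho> :: real
  assumes N: "N \<ge> 3" and R: "R > 0" and \<rho>: "\<rho> > 0"
    and nondegenerate: "dist p c \<noteq> R * cos (pi / of_nat N)"
begin

definition m :: real where "m = R * cos (pi / of_nat N)"
definition r :: real where "r = R * sin (pi / of_nat N)"
definition q :: complex where "q = p - c"

definition vertex_angle :: "real \<Rightarrow> int \<Rightarrow> real" where
  "vertex_angle t j = t + 2 * pi * of_int j / of_nat N"

text \<open>
  The power of \<open>p\<close> with respect to the base circle at angle \<open>\<phi>\<close>; see \<open>circle_power_eq\<close>.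
\<close>

definition circle_power :: "real \<Rightarrow> real" where
  "circle_power \<phi> = (cmod q)\<^sup>2 + m\<^sup>2 - 2 * R * Re (cnj q * cis \<phi>)"

text \<open>
  Centres, contact points and sides are functions of a continuous angle: a vertex at its own angle,
  a contact point or side at the angle halfway between two vertices.
\<close>

definition centre_at :: "real \<Rightarrow> complex" where
  "centre_at \<phi> = p + of_real (\<rho>\<^sup>2) * (of_real R * cis \<phi> - q) / of_real (circle_power \<phi>)"

definition contact_at :: "real \<Rightarrow> complex" where
  "contact_at \<psi> = inversion p \<rho> (c + of_real m * cis \<psi>)"

text \<open>
  The unit tangent to the image of the circle of radius \<open>m\<close>: the base tangent \<open>\<i> cis \<psi>\<close>
  reflected by the differential of the inversion. As a function of \<open>cis \<psi>\<close> it is a Moebius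
  transformation.
\<close>

definition side_direction :: "real \<Rightarrow> complex" where
  "side_direction \<psi> = \<i> * (of_real m * cis \<psi> - q) / (of_real m - cnj q * cis \<psi>)"

lemma pi_N: "0 < pi / real N" "pi / real N < pi / 2"
  using N by (auto simp: field_simps)

lemma m_pos: "m > 0" and r_pos: "r > 0"
proof -
  have "cos (pi / N) > 0" "sin (pi / N) > 0"
    using pi_N by (intro cos_gt_zero_pi sin_gt_zero; linarith)+
  thus "m > 0" "r > 0" using R by (simp_all add: m_def r_def)
qed

lemma m_r_squared: "m\<^sup>2 + r\<^sup>2 = R\<^sup>2"
  by (simp add: m_def r_def power_mult_distrib flip: distrib_left)

lemma norm_q: "cmod q \<noteq> m"
  using nondegenerate by (simp add: q_def m_def dist_norm)

lemma vertex_angle_shift: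
  "vertex_angle t (j + 1) = vertex_angle t j + 2 * (pi / N)"
  "vertex_angle t (j - 1) = vertex_angle t j - 2 * (pi / N)"
  using N by (simp_all add: vertex_angle_def field_simps)

lemma R_cis: "of_real R * cis (\<phi> + pi / N) = (m + \<i> * r) * cis \<phi>"
  "of_real R * cis (\<phi> - pi / N) = (m - \<i> * r) * cis \<phi>"
  by (simp_all add: complex_eq_iff m_def r_def cos_add sin_add cos_diff sin_diff algebra_simps)

lemma circle_power_complex:
  "of_real (circle_power \<phi>) = q * cnj q + of_real (m\<^sup>2) - R * (cnj q * cis \<phi> + q * cnj (cis \<phi>))"
  unfolding circle_power_def of_real_add of_real_diff complex_norm_square
  by (simp add: complex_eq_iff algebra_simps)

lemma circle_power_eq: "(cmod (of_real R * cis \<phi> - q))\<^sup>2 - r\<^sup>2 = circle_power \<phi>"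
proof -
  have "(cmod (of_real R * cis \<phi> - q))\<^sup>2 = R\<^sup>2 * ((cos \<phi>)\<^sup>2 + (sin \<phi>)\<^sup>2) + (cmod q)\<^sup>2 - 2 * R * Re (cnj q * cis \<phi>)"
    unfolding cmod_power2 distrib_left by (simp add: power2_eq_square algebra_simps)
  thus ?thesis by (simp add: circle_power_def flip: m_r_squared)
qed

lemma base_circle_eq: "base_circle N c R t j = sphere (c + of_real R * cis (vertex_angle t j)) r"
  by (simp add: base_circle_def regular_vertex_def vertex_angle_def r_def)

lemma avoids_base_circle:
  "p \<notin> base_circle N c R t j \<longleftrightarrow> circle_power (vertex_angle t j) \<noteq> 0"
proof -
  have "p \<in> base_circle N c R t j \<longleftrightarrow> cmod (of_real R * cis (vertex_angle t j) - q) = r"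
    by (simp add: base_circle_eq dist_norm q_def algebra_simps)
  also have "\<dots> \<longleftrightarrow> circle_power (vertex_angle t j) = 0"
    using r_pos by (simp add: power2_eq_iff_nonneg flip: circle_power_eq)
  finally show ?thesis by blast
qed

lemma steiner_porism_iff:
  "t \<in> steiner_porism N c R p \<longleftrightarrow> (\<forall>j. circle_power (vertex_angle t j) \<noteq> 0)"
  by (simp add: steiner_porism_def avoids_base_circle)

lemma soddy_vertex_eq:
  assumes "t \<in> steiner_porism N c R p"
  shows "soddy_vertex N c R p \<rho> t j = centre_at (vertex_angle t j)"
proof -
  define v where "v = c + of_real R * cis (vertex_angle t j)"
  have D: "circle_power (vertex_angle t j) \<noteq> 0" and p: "p \<notin> sphere v r"
    using assms avoids_base_circle[of t j] by (auto simp: steiner_porism_iff base_circle_eq v_def)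
  have vp: "v - p = of_real R * cis (vertex_angle t j) - q"
    by (simp add: v_def q_def)
  have "chain_circle N c R p \<rho> t j =
      sphere (centre_at (vertex_angle t j)) (\<rho>\<^sup>2 * r / \<bar>circle_power (vertex_angle t j)\<bar>)"
    using inversion_image_sphere[OF p r_pos \<rho>]
    unfolding vp circle_power_eq by (simp add: chain_circle_def base_circle_eq v_def centre_at_def)
  thus ?thesis
    using D \<rho> r_pos by (simp add: soddy_vertex_def circle_centre_sphere)
qed

text \<open>
  By the choice of \<open>r\<close> the two circles are externally tangent, so they meet in the midpoint of
  their centres.
\<close>

lemma base_circles_inter:
  "base_circle N c R t j \<inter> base_circle N c R t (j + 1) = {c + of_real m * cis (vertex_angle t j + pi / N)}"
proof -
  define E where "E = cis (vertex_angle t j + pi / N)"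
  have 1: "of_real R * cis (vertex_angle t j) = (m - \<i> * r) * E"
    using R_cis(2)[of "vertex_angle t j + pi / N"] by (simp add: E_def)
  have "vertex_angle t (j + 1) = vertex_angle t j + pi / N + pi / N"
    by (simp add: vertex_angle_shift(1))
  hence 2: "of_real R * cis (vertex_angle t (j + 1)) = (m + \<i> * r) * E"
    using R_cis(1)[of "vertex_angle t j + pi / N"] by (simp only: E_def)
  have "dist (c + (m - \<i> * r) * E) (c + (m + \<i> * r) * E) = cmod (of_real (2 * r) * (-\<i>) * E)"
    by (simp add: dist_norm algebra_simps del: of_real_mult) (simp add: algebra_simps)
  hence "dist (c + (m - \<i> * r) * E) (c + (m + \<i> * r) * E) = 2 * r"
    using r_pos by (simp add: norm_mult E_def)
  moreover have "midpoint (c + (m - \<i> * r) * E) (c + (m + \<i> * r) * E) = c + m * E"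
    by (simp add: midpoint_def scaleR_conv_of_real field_simps)
  ultimately show ?thesis
    unfolding base_circle_eq 1 2 E_def[symmetric]
    by (intro set_eqI) (simp only: tangent_spheres_midpoint singleton_iff)
qed

lemma contact_point_eq:
  assumes "t \<in> steiner_porism N c R p"
  shows "contact_point N c R p \<rho> t j = contact_at (vertex_angle t j + pi / N)"
proof -
  have p: "p \<notin> base_circle N c R t i" for i
    using assms by (simp add: steiner_porism_def)
  have "inj_on (inversion p \<rho>) (- {p})"
    by (rule inj_on_inverseI[of _ "inversion p \<rho>"]) (simp add: inversion_inversion \<rho>)
  hence "inversion p \<rho> ` (base_circle N c R t j \<inter> base_circle N c R t (j + 1)) =
      chain_circle N c R p \<rho> t j \<inter> chain_circle N c R p \<rho> t (j + 1)"
    unfolding chain_circle_def using p by (intro inj_on_image_Int) auto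
  hence "chain_circle N c R p \<rho> t j \<inter> chain_circle N c R p \<rho> t (j + 1)
      = {contact_at (vertex_angle t j + pi / N)}"
    by (simp add: base_circles_inter contact_at_def)
  thus ?thesis by (simp add: contact_point_def)
qed

lemma side_denominator: "of_real m - cnj q * cis \<psi> \<noteq> 0" "of_real m * cis \<psi> - q \<noteq> 0"
proof -
  show "of_real m - cnj q * cis \<psi> \<noteq> 0"
  proof
    assume "of_real m - cnj q * cis \<psi> = 0"
    hence "cmod (of_real m) = cmod (cnj q * cis \<psi>)" by simp
    thus False using norm_q m_pos by (simp add: norm_mult)
  qed
  show "of_real m * cis \<psi> - q \<noteq> 0"
  proof
    assume "of_real m * cis \<psi> - q = 0"
    hence "cmod (of_real m * cis \<psi>) = cmod q" by simp
    thus False using norm_q m_pos by (simp add: norm_mult)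
  qed
qed

lemma contact_at_eq: "contact_at \<psi> = p + of_real (\<rho>\<^sup>2) * cis \<psi> / (of_real m - cnj q * cis \<psi>)"
proof -
  have "cnj (of_real m * cis \<psi> - q) * cis \<psi> = of_real m - cnj q * cis \<psi>"
    by (simp add: algebra_simps cis_mult flip: cis_cnj) (simp add: cis_cnj cis_mult)
  hence "cnj (of_real m * cis \<psi> - q) = (of_real m - cnj q * cis \<psi>) / cis \<psi>"
    by (simp add: field_simps)
  thus ?thesis by (simp add: contact_at_def inversion_def q_def algebra_simps)
qed

lemma cmod_side_direction: "cmod (side_direction \<psi>) = 1"
proof -
  have "of_real m - cnj q * cis \<psi> = cis \<psi> * cnj (of_real m * cis \<psi> - q)"
    by (simp add: algebra_simps cis_cnj cis_mult)
  hence "cmod (of_real m - cnj q * cis \<psi>) = cmod (of_real m * cis \<psi> - q)"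
    by (simp only: norm_mult complex_mod_cnj norm_cis)
  thus ?thesis using side_denominator[of \<psi>] by (simp add: side_direction_def norm_mult norm_divide)
qed

text \<open>
  From a contact point, the centres of the two chain circles that meet there lie along the common
  tangent \<open>side_direction\<close>, at the signed distances \<open>- \<rho>\<^sup>2 r / D\<close> and \<open>\<rho>\<^sup>2 r / D\<close>. The two cases are
  one computation with the sign of \<open>r\<close> reversed.
\<close>

lemma centre_minus_contact:
  assumes "circle_power \<phi> \<noteq> 0"
  shows "centre_at \<phi> - contact_at (\<phi> + pi / N) = - of_real (\<rho>\<^sup>2 * r / circle_power \<phi>) * side_direction (\<phi> + pi / N)"
    and "centre_at \<phi> - contact_at (\<phi> - pi / N) = of_real (\<rho>\<^sup>2 * r / circle_power \<phi>) * side_direction (\<phi> - pi / N)"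
proof -
  have *: "centre_at \<phi> - contact_at \<psi> = - of_real (\<rho>\<^sup>2 * s / circle_power \<phi>) * side_direction \<psi>"
    if RV: "of_real R * cis \<phi> = (m - \<i> * s) * cis \<psi>" for \<psi> s
  proof -
    define E where "E = cis \<psi>"
    define q' where "q' = cnj q"
    define D where "D = complex_of_real (circle_power \<phi>)"
    have E: "cnj E * E = 1" by (simp add: E_def cis_cnj cis_mult)
    have "D = q * q' + of_real (m\<^sup>2) - q' * (of_real R * cis \<phi>) - q * cnj (of_real R * cis \<phi>)"
      by (simp add: D_def circle_power_complex q'_def algebra_simps)
    also have "cnj (of_real R * cis \<phi>) = (m + \<i> * s) * cnj E"
      unfolding RV by (simp add: E_def)
    finally have D: "D = q * q' + of_real (m\<^sup>2) - q' * ((m - \<i> * s) * E) - q * ((m + \<i> * s) * cnj E)"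
      by (simp add: RV E_def)
    have "D * E = q * q' * E + of_real (m\<^sup>2) * E - q' * ((m - \<i> * s) * E * E) - q * ((m + \<i> * s) * (cnj E * E))"
      unfolding D by (simp add: algebra_simps)
    hence DE: "((m - \<i> * s) * E - q) * (m - q' * E) - D * E = - (s * (\<i> * (m * E - q)))"
      unfolding E by (simp add: algebra_simps power2_eq_square)
    have nz: "D \<noteq> 0" "m - q' * E \<noteq> 0"
      using assms side_denominator[of \<psi>] by (auto simp: D_def q'_def E_def)
    have "centre_at \<phi> - contact_at \<psi> = of_real (\<rho>\<^sup>2) * (((m - \<i> * s) * E - q) / D - E / (m - q' * E))"
      unfolding centre_at_def contact_at_eq RV D_def[symmetric] E_def[symmetric] q'_def[symmetric]
      by (simp add: right_diff_distrib)
    also have "((m - \<i> * s) * E - q) / D - E / (m - q' * E) = (((m - \<i> * s) * E - q) * (m - q' * E) - D * E) / (D * (m - q' * E))"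
      using nz by (simp add: diff_frac_eq mult_ac)
    also have "\<dots> = - (s * (\<i> * (m * E - q))) / (D * (m - q' * E))"
      by (simp only: DE)
    finally show ?thesis
      by (simp add: side_direction_def D_def E_def q'_def)
  qed
  show "centre_at \<phi> - contact_at (\<phi> + pi / N) = - of_real (\<rho>\<^sup>2 * r / circle_power \<phi>) * side_direction (\<phi> + pi / N)"
    using R_cis(2)[of "\<phi> + pi / N"] by (intro *) simp
  show "centre_at \<phi> - contact_at (\<phi> - pi / N) = of_real (\<rho>\<^sup>2 * r / circle_power \<phi>) * side_direction (\<phi> - pi / N)"
    using *[of "-r" "\<phi> - pi / N"] R_cis(1)[of "\<phi> - pi / N"] by simp
qed

section \<open>Angles and turns of the polygon\<close>

text \<open>
  The two side directions at a vertex are related by twice the half angle: the quotient is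
  \<open>- (1 + \<i> w) / (1 - \<i> w)\<close>, where \<open>w\<close> carries both the size and the sign of the half-angle
  tangent.
\<close>

lemma side_direction_quotient:
  fixes \<phi> :: real
  defines "w \<equiv> m * circle_power \<phi> / (r * (m\<^sup>2 - (cmod q)\<^sup>2))"
  shows "side_direction (\<phi> - pi / N) / side_direction (\<phi> + pi / N) = - ((1 + \<i> * of_real w)\<^sup>2 / of_real (1 + w\<^sup>2))"
proof -
  define V where "V = cis \<phi>"
  define V' where "V' = cnj V"
  define E1 where "E1 = cis (\<phi> - pi / N)"
  define E2 where "E2 = cis (\<phi> + pi / N)"
  define q' where "q' = cnj q"
  define M where "M = m\<^sup>2 - (cmod q)\<^sup>2"
  define D where "D = circle_power \<phi>"
  have M: "M \<noteq> 0" using norm_q m_pos by (simp add: M_def power2_eq_iff_nonneg)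
  have Mc: "complex_of_real M = of_real (m\<^sup>2) - q * q'"
    unfolding M_def q'_def of_real_diff complex_norm_square ..
  have Dc: "complex_of_real D = q * q' + of_real (m\<^sup>2) - R * (q' * V + q * V')"
    unfolding D_def q'_def V_def V'_def circle_power_complex ..
  have V: "V * V' = 1" by (simp add: V_def V'_def cis_cnj cis_mult)
  have E: "R * E1 = (m - \<i> * r) * V" "R * E2 = (m + \<i> * r) * V" "E1 * E2 = V * V"
    using R_cis[of \<phi>] by (simp_all add: E1_def E2_def V_def cis_mult)
  \<comment> \<open>The common factor \<open>R\<close> makes \<open>R cis (\<pi>/N) = m + \<i> r\<close> available; the same reason underlies \<open>den\<close>.\<close>
  have num: "R * ((m * E1 - q) * (m - q' * E2)) = V * (m * D - \<i> * (r * M))"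
  proof -
    have "R * ((m * E1 - q) * (m - q' * E2)) =
        m^2 * (R * E1) - R * m * q' * (E1 * E2) - R * q * m * (V * V') + q * q' * (R * E2)"
      unfolding V by (simp add: algebra_simps power2_eq_square)
    also have "\<dots> = V * (m * D - \<i> * (r * M))"
      unfolding E of_real_mult Mc Dc by (simp add: algebra_simps power2_eq_square)
    finally show ?thesis .
  qed
  have den: "R * ((m - q' * E1) * (m * E2 - q)) = V * (m * D + \<i> * (r * M))"
  proof -
    have "R * ((m - q' * E1) * (m * E2 - q)) =
        m^2 * (R * E2) - R * m * q' * (E1 * E2) - R * q * m * (V * V') + q * q' * (R * E1)"
      unfolding V by (simp add: algebra_simps power2_eq_square)
    also have "\<dots> = V * (m * D + \<i> * (r * M))"
      unfolding E of_real_mult Mc Dc by (simp add: algebra_simps power2_eq_square)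
    finally show ?thesis .
  qed
  have w: "m * D = w * (r * M)" using M r_pos by (simp add: w_def D_def M_def)
  have nz: "1 - \<i> * of_real w \<noteq> 0" "1 + \<i> * of_real w \<noteq> 0"
    by (auto simp: complex_eq_iff)
  have "V \<noteq> 0" by (simp add: V_def)
  have "side_direction (\<phi> - pi / N) / side_direction (\<phi> + pi / N) =
      ((m * E1 - q) * (m - q' * E2)) / ((m - q' * E1) * (m * E2 - q))"
    by (simp add: side_direction_def E1_def E2_def q'_def)
  also have "\<dots> = (R * ((m * E1 - q) * (m - q' * E2))) / (R * ((m - q' * E1) * (m * E2 - q)))"
    using R by simp
  also have "\<dots> = (V * (m * D - \<i> * (r * M))) / (V * (m * D + \<i> * (r * M)))"
    unfolding num den ..
  also have "m * D - \<i> * (r * M) = (r * M) * (- \<i>) * (1 + \<i> * of_real w)"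
    using arg_cong[OF w, of complex_of_real] by (simp add: algebra_simps)
  also have "m * D + \<i> * (r * M) = (r * M) * \<i> * (1 - \<i> * of_real w)"
    using arg_cong[OF w, of complex_of_real] by (simp add: algebra_simps)
  also have "(V * ((r * M) * (- \<i>) * (1 + \<i> * of_real w))) / (V * ((r * M) * \<i> * (1 - \<i> * of_real w)))
      = - ((1 + \<i> * of_real w) / (1 - \<i> * of_real w))"
    using nz M r_pos \<open>V \<noteq> 0\<close> by simp
  also have "(1 + \<i> * of_real w) / (1 - \<i> * of_real w) = (1 + \<i> * of_real w)\<^sup>2 / ((1 - \<i> * of_real w) * (1 + \<i> * of_real w))"
    using nz by (simp add: power2_eq_square)
  also have "(1 - \<i> * of_real w) * (1 + \<i> * of_real w) = of_real (1 + w\<^sup>2)"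
    by (simp add: algebra_simps power2_eq_square)
  finally show ?thesis .
qed

lemma tan_half_side_angle:
  assumes t: "t \<in> steiner_porism N c R p"
  shows "tan (side_angle N c R p \<rho> t j / 2) =
    m / (r * \<bar>m\<^sup>2 - (cmod q)\<^sup>2\<bar>) * \<bar>circle_power (vertex_angle t j)\<bar>"
proof -
  define \<phi> where "\<phi> = vertex_angle t j"
  define w where "w = m * circle_power \<phi> / (r * (m\<^sup>2 - (cmod q)\<^sup>2))"
  define x where "x = complex_of_real (\<rho>\<^sup>2 * r / circle_power \<phi>)"
  have D: "circle_power \<phi> \<noteq> 0" using t by (auto simp: steiner_porism_iff \<phi>_def)
  hence x: "x \<noteq> 0" using \<rho> r_pos by (simp add: x_def)
  have w_pos: "1 + w\<^sup>2 > 0" by (simp add: add_pos_nonneg)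
  have "contact_point N c R p \<rho> t j - centre_at \<phi> = x * side_direction (\<phi> + pi / N)"
    using centre_minus_contact(1)[OF D] unfolding contact_point_eq[OF t] \<phi>_def[symmetric] x_def
    by (metis minus_diff_eq minus_mult_left minus_minus)
  moreover have "contact_point N c R p \<rho> t (j - 1) = contact_at (\<phi> - pi / N)"
    by (simp add: contact_point_eq[OF t] \<phi>_def vertex_angle_shift algebra_simps)
  hence "contact_point N c R p \<rho> t (j - 1) - centre_at \<phi> = - (x * side_direction (\<phi> - pi / N))"
    using centre_minus_contact(2)[OF D] unfolding x_def by (metis minus_diff_eq)
  ultimately have "(contact_point N c R p \<rho> t (j - 1) - centre_at \<phi>) / (contact_point N c R p \<rho> t j - centre_at \<phi>)
      = - (side_direction (\<phi> - pi / N) / side_direction (\<phi> + pi / N))"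
    using x by simp
  also have "\<dots> = of_real (1 / (1 + w\<^sup>2)) * (1 + \<i> * of_real w)\<^sup>2"
    unfolding side_direction_quotient w_def[symmetric] by simp
  finally have "tan (side_angle N c R p \<rho> t j / 2) = \<bar>w\<bar>"
    unfolding side_angle_def Let_def soddy_vertex_eq[OF t] \<phi>_def[symmetric]
    by (rule tan_half_abs_Arg) (use w_pos in simp)
  thus ?thesis using m_pos r_pos by (simp add: w_def abs_mult abs_divide \<phi>_def)
qed

text \<open>
  The sum is twice the squared distance from \<open>p\<close> to the base contact point between the two
  circles.
\<close>

lemma circle_power_add_next:
  "circle_power \<phi> + circle_power (\<phi> + 2 * (pi / N)) > 0"
proof -
  define \<psi> where "\<psi> = \<phi> + pi / N"
  have "R * (cis (\<psi> - pi / N) + cis (\<psi> + pi / N)) = 2 * m * cis \<psi>"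
    by (simp add: distrib_left R_cis algebra_simps)
  hence "Re (cnj q * (R * (cis (\<psi> - pi / N) + cis (\<psi> + pi / N)))) = Re (cnj q * (2 * m * cis \<psi>))"
    by simp
  hence "R * (Re (cnj q * cis (\<psi> - pi / N)) + Re (cnj q * cis (\<psi> + pi / N))) = 2 * m * Re (cnj q * cis \<psi>)"
    by (simp add: algebra_simps)
  hence "circle_power (\<psi> - pi / N) + circle_power (\<psi> + pi / N) = 2 * ((cmod q)\<^sup>2 + m\<^sup>2 - 2 * m * Re (cnj q * cis \<psi>))"
    by (simp add: circle_power_def algebra_simps)
  also have "(cmod q)\<^sup>2 + m\<^sup>2 - 2 * m * Re (cnj q * cis \<psi>) = (cmod (of_real m * cis \<psi> - q))\<^sup>2"
  proof -
    have "(cmod (of_real m * cis \<psi> - q))\<^sup>2 = m\<^sup>2 * ((cos \<psi>)\<^sup>2 + (sin \<psi>)\<^sup>2) + (cmod q)\<^sup>2 - 2 * m * Re (cnj q * cis \<psi>)"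
      unfolding cmod_power2 distrib_left by (simp add: power2_eq_square algebra_simps)
    thus ?thesis by simp
  qed
  also have "2 * \<dots> > 0" using side_denominator by simp
  finally show ?thesis by (simp add: \<psi>_def add_ac)
qed

text \<open>
  The side is the sum of the two signed pieces from the contact point, of lengths proportional to
  \<open>1 / D\<^sub>j\<close> and \<open>1 / D\<^sub>j\<^sub>+\<^sub>1\<close>. Since \<open>D\<^sub>j + D\<^sub>j\<^sub>+\<^sub>1 > 0\<close>, the direction is decided by the sign of the
  product.
\<close>

lemma side_vector:
  assumes t: "t \<in> steiner_porism N c R p"
  shows "\<exists>s>0. soddy_vertex N c R p \<rho> t (j + 1) - soddy_vertex N c R p \<rho> t j =
    of_real (s * (circle_power (vertex_angle t j) * circle_power (vertex_angle t (j + 1)))) *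
      side_direction (vertex_angle t j + pi / N)"
proof -
  define \<phi> where "\<phi> = vertex_angle t j"
  define \<psi> where "\<psi> = \<phi> + pi / N"
  define \<phi>' where "\<phi>' = vertex_angle t (j + 1)"
  have \<phi>': "\<phi>' = \<phi> + 2 * (pi / N)" "\<phi>' - pi / N = \<psi>"
    by (simp_all add: \<phi>_def \<phi>'_def \<psi>_def vertex_angle_shift)
  have D: "circle_power \<phi> \<noteq> 0" "circle_power \<phi>' \<noteq> 0"
    using t by (auto simp: steiner_porism_iff \<phi>_def \<phi>'_def)
  define s where "s = \<rho>\<^sup>2 * r * (circle_power \<phi> + circle_power \<phi>') / (circle_power \<phi> * circle_power \<phi>')\<^sup>2"
  have "s > 0"
    using D \<rho> r_pos circle_power_add_next[of \<phi>] by (simp add: s_def \<phi>'(1))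
  have "centre_at \<phi>' - centre_at \<phi> = of_real (\<rho>\<^sup>2 * r / circle_power \<phi>' + \<rho>\<^sup>2 * r / circle_power \<phi>) * side_direction \<psi>"
    using centre_minus_contact(1)[OF D(1)] centre_minus_contact(2)[OF D(2)]
    unfolding \<phi>'(2) \<psi>_def[symmetric] of_real_add distrib_right by (simp add: algebra_simps)
  also have "\<rho>\<^sup>2 * r / circle_power \<phi>' + \<rho>\<^sup>2 * r / circle_power \<phi> = s * (circle_power \<phi> * circle_power \<phi>')"
    using D by (simp add: s_def field_simps power2_eq_square)
  finally show ?thesis
    using \<open>s > 0\<close> unfolding soddy_vertex_eq[OF t] \<phi>_def \<phi>'_def \<psi>_def by blast
qed

text \<open>
  The directions of the two sides contribute the signs of \<open>D\<^sub>j\<^sub>-\<^sub>1 D\<^sub>j\<close> and \<open>D\<^sub>j D\<^sub>j\<^sub>+\<^sub>1\<close>, the turn between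
  the unit tangents contributes the sign of \<open>w\<close>, and the orientation of the family cancels the
  sign of \<open>m\<^sup>2 - d\<^sup>2\<close> in \<open>w\<close>, leaving that of \<open>D\<^sub>j\<close>.
\<close>

lemma inward_turn_iff:
  assumes t: "t \<in> steiner_porism N c R p"
  shows "inward_turn N c R p \<rho> t j \<longleftrightarrow>
    0 < circle_power (vertex_angle t (j - 1)) * circle_power (vertex_angle t j) * circle_power (vertex_angle t (j + 1))"
proof -
  define \<phi> where "\<phi> = vertex_angle t j"
  define D where "D i = circle_power (vertex_angle t i)" for i
  define e1 where "e1 = side_direction (\<phi> - pi / N)"
  define e2 where "e2 = side_direction (\<phi> + pi / N)"
  define M where "M = m\<^sup>2 - (cmod q)\<^sup>2"
  define w where "w = m * D j / (r * M)"
  have D: "D i \<noteq> 0" for i using t by (auto simp: steiner_porism_iff D_def)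
  have w_pos: "1 + w\<^sup>2 > 0" by (simp add: add_pos_nonneg)
  obtain s where s: "s > 0" "soddy_vertex N c R p \<rho> t (j + 1) - soddy_vertex N c R p \<rho> t j = of_real (s * (D j * D (j + 1))) * e2"
    using side_vector[OF t, of j] by (auto simp: D_def e2_def \<phi>_def)
  obtain s' where s': "s' > 0" "soddy_vertex N c R p \<rho> t j - soddy_vertex N c R p \<rho> t (j - 1) = of_real (s' * (D (j - 1) * D j)) * e1"
    using side_vector[OF t, of "j - 1"] by (auto simp: D_def e1_def \<phi>_def vertex_angle_shift(2) algebra_simps)
  have "e1 / e2 = e1 * cnj e2"
    using cmod_side_direction[of "\<phi> + pi / N"] by (simp add: complex_div_cnj[of e1 e2] flip: e2_def)
  hence "e1 * cnj e2 = - ((1 + \<i> * of_real w)\<^sup>2 / of_real (1 + w\<^sup>2))"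
    using side_direction_quotient[of \<phi>] by (simp add: e1_def e2_def w_def M_def D_def \<phi>_def)
  hence "Im (e1 * cnj e2) = - (2 * w / (1 + w\<^sup>2))"
    by (simp add: Im_divide_of_real power2_eq_square del: of_real_add)
  hence Im: "Im (e2 * cnj e1) = 2 * w / (1 + w\<^sup>2)" by (simp add: algebra_simps)
  have "(soddy_vertex N c R p \<rho> t (j + 1) - soddy_vertex N c R p \<rho> t j) * cnj (soddy_vertex N c R p \<rho> t j - soddy_vertex N c R p \<rho> t (j - 1))
     = of_real (s * s' * (D j)\<^sup>2 * (D (j - 1) * D (j + 1))) * (e2 * cnj e1)"
    unfolding s s' by (simp add: power2_eq_square)
  hence turn: "Im ((soddy_vertex N c R p \<rho> t (j + 1) - soddy_vertex N c R p \<rho> t j) * cnj (soddy_vertex N c R p \<rho> t j - soddy_vertex N c R p \<rho> t (j - 1)))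
     = s * s' * (D j)\<^sup>2 * (D (j - 1) * D (j + 1)) * (2 * w / (1 + w\<^sup>2))"
    using Im by (simp only: times_complex.sel Re_complex_of_real Im_complex_of_real)
  have oriented: "family_orientation N c R p * w = m * D j / (r * \<bar>M\<bar>)"
  proof -
    have "cmod q < m \<longleftrightarrow> M > 0"
      unfolding M_def diff_gt_0_iff_gt
      using m_pos power_mono_iff[of m "cmod q" 2] by (metis linorder_not_le norm_ge_zero less_imp_le pos2)
    thus ?thesis
      by (simp add: family_orientation_def w_def q_def m_def dist_norm)
  qed
  have "family_orientation N c R p * Im ((soddy_vertex N c R p \<rho> t (j + 1) - soddy_vertex N c R p \<rho> t j) * cnj (soddy_vertex N c R p \<rho> t j - soddy_vertex N c R p \<rho> t (j - 1)))
      = (2 * s * s' * (D j)\<^sup>2 * m / (r * \<bar>M\<bar>) / (1 + w\<^sup>2)) * (D (j - 1) * D j * D (j + 1))"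
  proof -
    have swap: "o' * (X * (2 * w / (1 + w\<^sup>2))) = 2 * X / (1 + w\<^sup>2) * (o' * w)" for o' X :: real by simp
    show ?thesis unfolding turn swap oriented by (simp add: mult_ac)
  qed
  moreover have "M \<noteq> 0" using norm_q m_pos by (simp add: M_def power2_eq_iff_nonneg)
  hence "2 * s * s' * (D j)\<^sup>2 * m / (r * \<bar>M\<bar>) / (1 + w\<^sup>2) > 0"
    using s(1) s'(1) D[of j] m_pos r_pos w_pos by simp
  ultimately show ?thesis
    unfolding inward_turn_def Let_def D_def[symmetric] by (simp only: zero_less_mult_iff) auto
qed

section \<open>Branches of the conic\<close>

lemma hyperbola_iff: "z \<in> hyperbola F G a \<longleftrightarrow> \<bar>dist z F - dist z G\<bar> = \<bar>2 * a\<bar>"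
  by (auto simp: hyperbola_def hyperbola_branch_def)

lemma circle_power_cos:
  "circle_power \<phi> = (cmod q)\<^sup>2 + m\<^sup>2 - 2 * R * cmod q * cos (\<phi> - Arg q)"
proof -
  have "q = cmod q * cis (Arg q)"
    by (metis rcis_cmod_Arg rcis_def)
  hence "cnj q * cis \<phi> = cmod q * cis (\<phi> - Arg q)"
    by (metis cis_cnj cis_mult complex_cnj_complex_of_real complex_cnj_mult mult.assoc add.commute uminus_add_conv_diff)
  thus ?thesis by (simp add: circle_power_def)
qed

lemma countable_circle_power_zeros: "countable {\<phi>. circle_power \<phi> = 0}"
proof (cases "q = 0")
  case True
  thus ?thesis using m_pos by (simp add: circle_power_def)
next
  case False
  define K where "K = ((cmod q)\<^sup>2 + m\<^sup>2) / (2 * R * cmod q)"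
  have "{\<phi>. circle_power \<phi> = 0} \<subseteq> (\<lambda>x. x + Arg q) ` {x. cos x = K}"
  proof
    fix \<phi> assume "\<phi> \<in> {\<phi>. circle_power \<phi> = 0}"
    hence "cos (\<phi> - Arg q) = K"
      using False R by (simp add: circle_power_cos K_def field_simps)
    thus "\<phi> \<in> (\<lambda>x. x + Arg q) ` {x. cos x = K}"
      by (intro image_eqI[of _ _ "\<phi> - Arg q"]) auto
  qed
  thus ?thesis by (rule countable_subset) (intro countable_image countable_cos_eq)
qed

lemma countable_outside_porism: "countable (- steiner_porism N c R p)"
proof -
  have "- steiner_porism N c R p \<subseteq> (\<Union>j::int. (\<lambda>\<phi>. \<phi> - 2 * pi * of_int j / of_nat N) ` {\<phi>. circle_power \<phi> = 0})"
  proof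
    fix t assume "t \<in> - steiner_porism N c R p"
    then obtain j where "circle_power (vertex_angle t j) = 0"
      by (auto simp: steiner_porism_iff)
    thus "t \<in> (\<Union>j::int. (\<lambda>\<phi>. \<phi> - 2 * pi * of_int j / of_nat N) ` {\<phi>. circle_power \<phi> = 0})"
      by (intro UN_I[of j] image_eqI[of _ _ "vertex_angle t j"]) (auto simp: vertex_angle_def)
  qed
  thus ?thesis
    by (rule countable_subset) (intro countable_UN countable_image countable_circle_power_zeros; simp)
qed

lemma continuous_circle_power: "continuous_on A circle_power"
  unfolding circle_power_def[abs_def] by (intro continuous_intros)

lemma continuous_centre_at: "continuous_on {\<phi>. circle_power \<phi> \<noteq> 0} centre_at"
  unfolding centre_at_def[abs_def]
  by (intro continuous_intros continuous_circle_power) auto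

text \<open>
  The rotation angles outside the porism are countable, so the hyperbola condition extends by
  continuity to every centre at a finite place, even when another circle of that chain is a line.
\<close>

lemma centres_on_hyperbola:
  assumes hyp: "\<forall>s\<in>steiner_porism N c R p. \<forall>i. soddy_vertex N c R p \<rho> s i \<in> hyperbola F G a"
    and \<phi>: "circle_power \<phi> \<noteq> 0"
  shows "centre_at \<phi> \<in> hyperbola F G a"
proof (rule ccontr)
  assume neg: "centre_at \<phi> \<notin> hyperbola F G a"
  define g where "g x = \<bar>dist (centre_at x) F - dist (centre_at x) G\<bar>" for x
  define U where "U = {x. circle_power x \<noteq> 0}"
  define S where "S = {x \<in> U. g x \<noteq> \<bar>2 * a\<bar>}"
  have "U = circle_power -` (- {0})" by (auto simp: U_def)
  hence "open U"
    using open_vimage[of "- {0}" circle_power] continuous_circle_power by (simp add: open_Compl)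
  moreover have "continuous_on U g"
    unfolding g_def[abs_def] U_def by (intro continuous_intros continuous_centre_at)
  moreover have "S = U \<inter> g -` (- {\<bar>2 * a\<bar>})" by (auto simp: S_def)
  ultimately have "open S" by (metis continuous_open_preimage open_Compl closed_singleton)
  moreover have "\<phi> \<in> S" using neg \<phi> by (simp add: S_def U_def g_def hyperbola_iff)
  ultimately obtain s where s: "s \<in> S" "s \<in> steiner_porism N c R p"
    using open_minus_countable[OF countable_outside_porism, of S] by auto
  have "centre_at s \<in> hyperbola F G a"
    using hyp s(2) soddy_vertex_eq[OF s(2), of 0] by (auto simp: vertex_angle_def dest!: bspec spec[of _ 0])
  thus False using s(1) by (simp add: S_def g_def hyperbola_iff)
qed

text \<open>
  \<open>D\<close> is an affine function of a cosine, so its positive and its negative set are arcs of the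
  circle of angles.
\<close>

lemma same_sign_arc:
  assumes "circle_power x * circle_power y > 0"
  shows "\<exists>x' y'. cis x' = cis x \<and> cis y' = cis y \<and> (\<forall>z\<in>closed_segment x' y'. circle_power z \<noteq> 0)"
proof (cases "circle_power x > 0")
  case True
  hence pos: "circle_power x > 0" "circle_power y > 0" using assms by (auto simp: zero_less_mult_iff)
  obtain x' y' where xy: "cis x' = cis x" "cis y' = cis y"
    and le: "\<And>z. z \<in> closed_segment x' y' \<Longrightarrow> cos (z - Arg q) \<le> max (cos (x - Arg q)) (cos (y - Arg q))"
    using cos_arc_maximum by blast
  have "circle_power z > 0" if "z \<in> closed_segment x' y'" for z
  proof -
    have "circle_power z \<ge> circle_power x \<or> circle_power z \<ge> circle_power y"
      using le[OF that] R unfolding circle_power_cos le_max_iff_disj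
      by (auto simp: mult_left_mono)
    thus ?thesis using pos by linarith
  qed
  thus ?thesis using xy by (metis less_irrefl)
next
  case False
  hence neg: "circle_power x < 0" "circle_power y < 0" using assms by (auto simp: zero_less_mult_iff)
  obtain x' y' where xy: "cis x' = cis x" "cis y' = cis y"
    and le: "\<And>z. z \<in> closed_segment x' y' \<Longrightarrow>
      cos (z - (Arg q + pi)) \<le> max (cos (x - (Arg q + pi))) (cos (y - (Arg q + pi)))"
    using cos_arc_maximum by blast
  have cos_shift: "cos (z - (Arg q + pi)) = - cos (z - Arg q)" for z
    using cos_minus_pi[of "z - Arg q"] by (simp add: algebra_simps)
  have "circle_power z < 0" if "z \<in> closed_segment x' y'" for z
  proof -
    have "circle_power z \<le> circle_power x \<or> circle_power z \<le> circle_power y"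
      using le[OF that] R unfolding circle_power_cos le_max_iff_disj cos_shift
      by (auto simp: mult_left_mono)
    thus ?thesis using neg by linarith
  qed
  thus ?thesis using xy by (metis less_irrefl)
qed

lemma centre_at_cong: "cis x = cis y \<Longrightarrow> centre_at x = centre_at y"
  by (simp add: centre_at_def circle_power_def)

text \<open>
  Along an arc without zeros of \<open>D\<close> the difference of the distances to the foci is continuous with
  values \<open>2 a\<close> and \<open>- 2 a\<close> only, hence constant.
\<close>

lemma same_branch:
  assumes hyp: "\<forall>s\<in>steiner_porism N c R p. \<forall>i. soddy_vertex N c R p \<rho> s i \<in> hyperbola F G a"
    and "a > 0" and "circle_power x * circle_power y > 0"
    and x: "centre_at x \<in> hyperbola_branch F G a"
  shows "centre_at y \<in> hyperbola_branch F G a"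
proof -
  obtain x' y' where xy: "cis x' = cis x" "cis y' = cis y"
    and nz: "\<forall>z\<in>closed_segment x' y'. circle_power z \<noteq> 0"
    using same_sign_arc assms(3) by blast
  define h where "h z = dist (centre_at z) F - dist (centre_at z) G" for z
  have "continuous_on (closed_segment x' y') h"
    unfolding h_def[abs_def] using nz
    by (intro continuous_intros continuous_on_subset[OF continuous_centre_at]) auto
  hence conn: "connected (h ` closed_segment x' y')"
    by (rule connected_continuous_image) simp
  have "\<bar>h z\<bar> = 2 * a" if "z \<in> closed_segment x' y'" for z
    using centres_on_hyperbola[OF hyp] nz that \<open>a > 0\<close> by (simp add: hyperbola_iff h_def)
  moreover have "h x' = 2 * a"
    using x centre_at_cong[OF xy(1)] by (simp add: hyperbola_branch_def h_def)
  ultimately have "h y' = 2 * a"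
    using connectedD_interval[OF conn, of "h y'" "h x'" 0] \<open>a > 0\<close>
    by (smt (verit) ends_in_segment imageE image_eqI)
  thus ?thesis
    using centre_at_cong[OF xy(2)] by (simp add: hyperbola_branch_def h_def)
qed

text \<open>
  For \<open>s = R - r\<close> and \<open>s = - R - r\<close> the reference point is the centre of the inner or outer Soddy
  circle, and \<open>\<rho>\<^sup>2 s / B\<close> is its signed radius: the distance between the centres of tangent circles
  is the absolute value of the sum of their signed radii.
\<close>

lemma soddy_centre_distance:
  fixes \<phi> s B :: real
  assumes D: "circle_power \<phi> \<noteq> 0" and s: "(r + s)\<^sup>2 = R\<^sup>2" and B: "B = (cmod q)\<^sup>2 - s\<^sup>2" "B \<noteq> 0"
  shows "dist (centre_at \<phi>) (p - of_real (\<rho>\<^sup>2 / B) * q) = \<rho>\<^sup>2 * \<bar>r / circle_power \<phi> + s / B\<bar>"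
proof -
  define D where "D = circle_power \<phi>"
  define w where "w = of_real R * cis \<phi> - q"
  have D0: "D \<noteq> 0" using D by (simp add: D_def)
  have w: "(cmod w)\<^sup>2 = D + r\<^sup>2" using circle_power_eq[of \<phi>] by (simp add: w_def D_def)
  have "(cmod (w + q))\<^sup>2 = R\<^sup>2" using R by (simp add: w_def norm_mult)
  moreover have "(cmod (w + q))\<^sup>2 = (cmod w)\<^sup>2 + (cmod q)\<^sup>2 + 2 * Re (w * cnj q)"
    unfolding cmod_power2 by (simp add: power2_eq_square algebra_simps)
  ultimately have wq: "2 * Re (w * cnj q) = R\<^sup>2 - D - r\<^sup>2 - (cmod q)\<^sup>2" using w by simp
  have "(cmod (w / D + q / B))\<^sup>2 = (cmod w)\<^sup>2 / D\<^sup>2 + 2 * Re (w * cnj q) / (D * B) + (cmod q)\<^sup>2 / B\<^sup>2"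
    unfolding cmod_power2 using D0 B(2)
    by (simp add: Re_divide_of_real Im_divide_of_real field_simps power2_eq_square)
  also have "\<dots> = (D + r\<^sup>2) / D\<^sup>2 + (R\<^sup>2 - D - r\<^sup>2 - (cmod q)\<^sup>2) / (D * B) + (B + s\<^sup>2) / B\<^sup>2"
    unfolding w wq by (simp add: B(1))
  also have "R\<^sup>2 - D - r\<^sup>2 - (cmod q)\<^sup>2 = 2 * r * s - D - B"
    using s B(1) by (simp add: power2_eq_square algebra_simps)
  also have "(D + r\<^sup>2) / D\<^sup>2 + (2 * r * s - D - B) / (D * B) + (B + s\<^sup>2) / B\<^sup>2 = (r / D + s / B)\<^sup>2"
    using D0 B(2) by (simp add: field_simps power2_eq_square)
  finally have "cmod (w / D + q / B) = \<bar>r / D + s / B\<bar>"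
    by (metis abs_norm_cancel power2_eq_iff_nonneg abs_ge_zero power2_abs)
  moreover have "centre_at \<phi> - (p - of_real (\<rho>\<^sup>2 / B) * q) = of_real (\<rho>\<^sup>2) * (w / D + q / B)"
    by (simp add: centre_at_def w_def D_def algebra_simps)
  ultimately show ?thesis
    by (simp only: dist_norm norm_mult norm_of_real D_def) simp
qed

text \<open>
  A negative power means that \<open>p\<close> lies between the concentric Soddy circles. The foci are the
  centres of their images. Of the two summands in \<open>soddy_centre_distance\<close> the second is positive for
  both foci, and for \<open>D < 0\<close> the first one outweighs it. So neither absolute
  value is taken of an expression with the opposite sign of \<open>D\<close>, and in the difference of the distances \<open>r / D\<close> cancels. What
  remains is nonzero because \<open>d \<noteq> m\<close>.
\<close>

lemma soddy_conic_hyperbola: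
  assumes neg: "circle_power \<phi>\<^sub>0 < 0"
  shows "\<exists>F G \<delta>. \<delta> \<noteq> 0 \<and> \<bar>\<delta>\<bar> < dist F G \<and>
    (\<forall>\<phi>. circle_power \<phi> \<noteq> 0 \<longrightarrow> dist (centre_at \<phi>) F - dist (centre_at \<phi>) G = sgn (circle_power \<phi>) * \<delta>)"
proof -
  define d where "d = cmod q"
  define A where "A = d\<^sup>2 - (R - r)\<^sup>2"
  define B where "B = (R + r)\<^sup>2 - d\<^sup>2"
  have Rr: "r < R" using R pi_N m_pos r_pos m_r_squared by (smt (verit) power_mono_iff zero_less_power power2_less_imp_less)
  have low: "circle_power \<phi> \<ge> (R - d)\<^sup>2 - r\<^sup>2" for \<phi>
  proof -
    have "2 * R * d * cos (\<phi> - Arg q) \<le> 2 * R * d * 1"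
      using R by (intro mult_left_mono) (auto simp: d_def)
    hence "circle_power \<phi> \<ge> d\<^sup>2 + m\<^sup>2 - 2 * R * d" by (simp add: circle_power_cos d_def)
    also have "d\<^sup>2 + m\<^sup>2 - 2 * R * d = (R - d)\<^sup>2 - r\<^sup>2"
      using m_r_squared by (simp add: power2_eq_square algebra_simps)
    finally show ?thesis .
  qed
  have "(R - d)\<^sup>2 < r\<^sup>2" using low[of \<phi>\<^sub>0] neg by linarith
  hence "\<bar>R - d\<bar> < r" using r_pos by (metis abs_le_square_iff abs_of_pos not_le)
  hence d: "R - r < d" "d < R + r" by linarith+
  have A_eq: "A = (d - R + r) * (d + R - r)" and B_eq: "B = (R + r - d) * (R + r + d)"
    by (simp_all add: A_def B_def power2_eq_square algebra_simps)
  have A: "A > 0" and B: "B > 0" using d Rr R r_pos by (simp_all add: A_eq B_eq)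
  define \<delta> where "\<delta> = (R - r) / A - (R + r) / B"
  define F where "F = p - of_real (\<rho>\<^sup>2 / A) * q"
  define G where "G = p - of_real (\<rho>\<^sup>2 / (- B)) * q"
  have "(R - r) * B - (R + r) * A = 2 * R * (m\<^sup>2 - d\<^sup>2)"
    unfolding A_def B_def using m_r_squared by (simp add: power2_eq_square algebra_simps) algebra
  moreover have "m\<^sup>2 - d\<^sup>2 \<noteq> 0" using norm_q m_pos by (simp add: d_def power2_eq_iff_nonneg)
  ultimately have "(R - r) * B - (R + r) * A \<noteq> 0" using R by simp
  hence \<delta>0: "\<delta> \<noteq> 0" using A B by (simp add: \<delta>_def field_simps)
  have "F - G = - of_real (\<rho>\<^sup>2 * (1 / A + 1 / B)) * q"
    by (simp add: F_def G_def algebra_simps add_divide_distrib)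
  hence "dist F G = \<bar>\<rho>\<^sup>2 * (1 / A + 1 / B)\<bar> * d"
    by (simp only: dist_norm norm_mult norm_minus_cancel norm_of_real d_def)
  hence FG: "dist F G = \<rho>\<^sup>2 * (d / A + d / B)"
    using A B by (simp add: distrib_left field_simps)
  have "\<bar>\<delta>\<bar> < d / A + d / B"
  proof -
    have "(R - r) / A < d / A" "(R + r) / B > 0" "d / B > 0" using A B d R r_pos Rr
      by (simp_all add: divide_strict_right_mono)
    hence 1: "\<delta> < d / A + d / B" by (simp add: \<delta>_def)
    have "(R + r - d) / B = 1 / (R + r + d)" "(d + R - r) / A = 1 / (d - R + r)"
      using d Rr by (simp_all add: A_eq B_eq)
    moreover have "1 / (R + r + d) < 1 / (d - R + r)" using d Rr R by (intro divide_strict_left_mono) auto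
    ultimately have "(R + r - d) / B < (d + R - r) / A" by simp
    hence 2: "- \<delta> < d / A + d / B" by (simp add: \<delta>_def add_divide_distrib diff_divide_distrib)
    from 1 2 show ?thesis by linarith
  qed
  hence "\<bar>\<rho>\<^sup>2 * \<delta>\<bar> < dist F G"
    using \<rho> by (simp add: FG abs_mult)
  moreover have "dist (centre_at \<phi>) F - dist (centre_at \<phi>) G = sgn (circle_power \<phi>) * (\<rho>\<^sup>2 * \<delta>)"
    if D: "circle_power \<phi> \<noteq> 0" for \<phi>
  proof -
    define D where "D = circle_power \<phi>"
    have F: "dist (centre_at \<phi>) F = \<rho>\<^sup>2 * \<bar>r / D + (R - r) / A\<bar>"
      unfolding F_def D_def using A by (intro soddy_centre_distance D) (simp_all add: A_def d_def)
    have "dist (centre_at \<phi>) G = \<rho>\<^sup>2 * \<bar>r / D + (- R - r) / (- B)\<bar>"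
      unfolding G_def D_def using B by (intro soddy_centre_distance D) (simp_all add: B_def d_def power2_eq_square algebra_simps)
    hence G: "dist (centre_at \<phi>) G = \<rho>\<^sup>2 * \<bar>r / D + (R + r) / B\<bar>"
      by (metis minus_add_distrib minus_divide_divide uminus_add_conv_diff add.commute diff_minus_eq_add)
    show ?thesis
    proof (cases "D > 0")
      case True
      hence "r / D + (R - r) / A > 0" "r / D + (R + r) / B > 0"
        using A B R r_pos Rr by (simp_all add: add_pos_pos)
      thus ?thesis unfolding F G using True by (simp add: D_def \<delta>_def algebra_simps)
    next
      case False
      define n where "n = - D"
      have n: "n > 0" "n \<le> r\<^sup>2 - (R - d)\<^sup>2" using False that low[of \<phi>] by (auto simp: n_def D_def)
      \<comment> \<open>The extreme case is the least value of \<open>D\<close>, at which the differences are multiples of squares.\<close>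
      have "r * A - (R - r) * (r\<^sup>2 - (R - d)\<^sup>2) = R * (d - R + r)\<^sup>2"
        unfolding A_def by (simp add: power2_eq_square algebra_simps)
      hence "(R - r) * (r\<^sup>2 - (R - d)\<^sup>2) \<le> r * A" using R by (metis diff_ge_0_iff_ge mult_nonneg_nonneg less_imp_le zero_le_power2)
      moreover have "(R - r) * n \<le> (R - r) * (r\<^sup>2 - (R - d)\<^sup>2)" using n Rr by (intro mult_left_mono) auto
      ultimately have "(R - r) / A \<le> r / n" using n A by (simp add: field_simps)
      moreover have "r * B - (R + r) * (r\<^sup>2 - (R - d)\<^sup>2) = R * (R + r - d)\<^sup>2"
        unfolding B_def by (simp add: power2_eq_square algebra_simps)
      hence "(R + r) * (r\<^sup>2 - (R - d)\<^sup>2) \<le> r * B" using R by (metis diff_ge_0_iff_ge mult_nonneg_nonneg less_imp_le zero_le_power2)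
      moreover have "(R + r) * n \<le> (R + r) * (r\<^sup>2 - (R - d)\<^sup>2)" using n R r_pos by (intro mult_left_mono) auto
      ultimately have "(R - r) / A \<le> r / n" "(R + r) / B \<le> r / n" using n B by (simp_all add: field_simps)
      hence le: "r / D + (R - r) / A \<le> 0" "r / D + (R + r) / B \<le> 0" by (simp_all add: n_def)
      have "sgn D = - 1" using n by (simp add: n_def)
      moreover have "\<rho>\<^sup>2 * - (x + a) - \<rho>\<^sup>2 * - (x + b) = - 1 * (\<rho>\<^sup>2 * (a - b))" for x a b
        by (simp add: algebra_simps)
      ultimately show ?thesis
        unfolding F G D_def[symmetric] \<delta>_def by (simp only: abs_of_nonpos[OF le(1)] abs_of_nonpos[OF le(2)])
    qed
  qed
  moreover have "\<rho>\<^sup>2 * \<delta> \<noteq> 0" using \<delta>0 \<rho> by simp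
  ultimately show ?thesis by blast
qed

lemma neighbours_on_different_branches_iff:
  assumes t: "t \<in> steiner_porism N c R p"
  shows "neighbours_on_different_branches N c R p \<rho> t j \<longleftrightarrow>
    circle_power (vertex_angle t (j - 1)) * circle_power (vertex_angle t (j + 1)) < 0"
    (is "_ \<longleftrightarrow> ?D1 * ?D2 < 0")
proof
  assume "neighbours_on_different_branches N c R p \<rho> t j"
  then obtain F G a where "0 < a"
    and hyp: "\<forall>s\<in>steiner_porism N c R p. \<forall>i. soddy_vertex N c R p \<rho> s i \<in> hyperbola F G a"
    and 1: "centre_at (vertex_angle t (j - 1)) \<in> hyperbola_branch F G a"
    and 2: "centre_at (vertex_angle t (j + 1)) \<in> hyperbola_branch G F a"
    unfolding neighbours_on_different_branches_def soddy_vertex_eq[OF t] by blast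
  have "\<not> ?D1 * ?D2 > 0"
    using same_branch[OF hyp \<open>0 < a\<close> _ 1] 2 \<open>0 < a\<close> by (fastforce simp: hyperbola_branch_def)
  moreover have "?D1 * ?D2 \<noteq> 0" using t by (simp add: steiner_porism_iff)
  ultimately show "?D1 * ?D2 < 0" by linarith
next
  assume D: "?D1 * ?D2 < 0"
  then obtain F G \<delta> where \<delta>: "\<delta> \<noteq> 0" "\<bar>\<delta>\<bar> < dist F G"
    and h: "\<And>\<phi>. circle_power \<phi> \<noteq> 0 \<Longrightarrow> dist (centre_at \<phi>) F - dist (centre_at \<phi>) G = sgn (circle_power \<phi>) * \<delta>"
    using soddy_conic_hyperbola by (metis mult_less_0_iff)
  \<comment> \<open>The two foci may have to be exchanged, so that the branch of vertex \<open>j - 1\<close> is the first one.\<close>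
  have witness: "neighbours_on_different_branches N c R p \<rho> t j"
    if "\<epsilon> \<noteq> 0" "\<bar>\<epsilon>\<bar> < dist F' G'" "?D1 * \<epsilon> > 0"
      and h': "\<And>\<phi>. circle_power \<phi> \<noteq> 0 \<Longrightarrow> dist (centre_at \<phi>) F' - dist (centre_at \<phi>) G' = sgn (circle_power \<phi>) * \<epsilon>"
    for F' G' \<epsilon>
    unfolding neighbours_on_different_branches_def
  proof (rule exI[of _ F'], rule exI[of _ G'], rule exI[of _ "\<bar>\<epsilon>\<bar> / 2"], intro conjI ballI allI)
    fix s i assume s: "s \<in> steiner_porism N c R p"
    hence "circle_power (vertex_angle s i) \<noteq> 0" by (simp add: steiner_porism_iff)
    thus "soddy_vertex N c R p \<rho> s i \<in> hyperbola F' G' (\<bar>\<epsilon>\<bar> / 2)"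
      by (simp add: soddy_vertex_eq[OF s] hyperbola_iff h' abs_mult abs_sgn_eq)
  next
    have nz: "?D1 \<noteq> 0" "?D2 \<noteq> 0" using t by (auto simp: steiner_porism_iff)
    have "sgn ?D1 * \<epsilon> = \<bar>\<epsilon>\<bar>" using that(3) by (auto simp: zero_less_mult_iff)
    thus "soddy_vertex N c R p \<rho> t (j - 1) \<in> hyperbola_branch F' G' (\<bar>\<epsilon>\<bar> / 2)"
      by (simp add: soddy_vertex_eq[OF t] hyperbola_branch_def h' nz)
    have "sgn ?D2 * \<epsilon> = - \<bar>\<epsilon>\<bar>" using that(3) D by (auto simp: zero_less_mult_iff mult_less_0_iff)
    thus "soddy_vertex N c R p \<rho> t (j + 1) \<in> hyperbola_branch G' F' (\<bar>\<epsilon>\<bar> / 2)"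
      using h'[OF nz(2)] by (simp add: soddy_vertex_eq[OF t] hyperbola_branch_def)
  qed (use that in auto)
  show "neighbours_on_different_branches N c R p \<rho> t j"
  proof (cases "?D1 * \<delta> > 0")
    case True
    thus ?thesis using \<delta> h by (intro witness[of \<delta> F G])
  next
    case False
    hence "?D1 * - \<delta> > 0" using D \<delta>(1) by (auto simp: zero_less_mult_iff mult_less_0_iff)
    moreover have "dist (centre_at \<phi>) G - dist (centre_at \<phi>) F = sgn (circle_power \<phi>) * - \<delta>"
      if "circle_power \<phi> \<noteq> 0" for \<phi> using h[OF that] by simp
    ultimately show ?thesis using \<delta> by (intro witness[of "- \<delta>" G F]) (auto simp: dist_commute)
  qed
qed

section \<open>The half-angle tangents and their power sums\<close>

text \<open>
  The sign of \<open>D\<^sub>j\<^sub>-\<^sub>1 D\<^sub>j\<^sub>+\<^sub>1\<close> enters twice, through the branches and through the turn, and cancels.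
\<close>

lemma half_angle_tangent_eq:
  assumes t: "t \<in> steiner_porism N c R p"
  shows "half_angle_tangent N c R p \<rho> t j =
    m / (r * \<bar>m\<^sup>2 - (cmod q)\<^sup>2\<bar>) * circle_power (vertex_angle t j)"
proof -
  define D where "D i = circle_power (vertex_angle t i)" for i
  define C where "C = m / (r * \<bar>m\<^sup>2 - (cmod q)\<^sup>2\<bar>)"
  have nz: "D i \<noteq> 0" for i using t by (simp add: steiner_porism_iff D_def)
  have "tan (internal_angle N c R p \<rho> t j / 2) =
      (if D (j - 1) * D j * D (j + 1) > 0 then 1 else - 1) * tan (side_angle N c R p \<rho> t j / 2)"
  proof -
    have "tan (pi - x) = - tan x" for x :: real by (simp add: tan_def)
    thus ?thesis by (simp add: internal_angle_def inward_turn_iff[OF t] D_def diff_divide_distrib)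
  qed
  hence "half_angle_tangent N c R p \<rho> t j =
     (if D (j - 1) * D (j + 1) < 0 then - 1 else 1) * (if D (j - 1) * D j * D (j + 1) > 0 then 1 else - 1)
       * (C * \<bar>D j\<bar>)"
    by (simp add: C_def half_angle_tangent_def neighbours_on_different_branches_iff[OF t] D_def tan_half_side_angle[OF t])
  also have "(if D (j - 1) * D (j + 1) < 0 then - 1 else 1) * (if D (j - 1) * D j * D (j + 1) > 0 then 1 else - 1) = sgn (D j)"
    using nz[of j] nz[of "j - 1"] nz[of "j + 1"]
    by (auto simp: sgn_if zero_less_mult_iff mult_less_0_iff)
  also have "sgn (D j) * (C * \<bar>D j\<bar>) = C * D j"
    using mult_sgn_abs[of "D j"] by (metis mult.left_commute)
  finally show ?thesis by (simp only: C_def D_def)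
qed

lemma circle_power_sum_constant:
  assumes "k < N"
  shows "(\<Sum>j\<in>{1..int N}. circle_power (vertex_angle t j) ^ k) = (\<Sum>j\<in>{1..int N}. circle_power (vertex_angle s j) ^ k)"
proof -
  define S where "S t = (\<Sum>j\<in>{1..int N}. circle_power (vertex_angle t j) ^ k)" for t
  have eq: "of_real (S t) = (\<Sum>j\<in>{1..int N}. ((q * cnj q + of_real (m\<^sup>2)) + (- R * cnj q) * cis (t + 2 * pi * of_int j / of_nat N)
     + (- R * q) * cnj (cis (t + 2 * pi * of_int j / of_nat N))) ^ k * cis (of_int 0 * (t + 2 * pi * of_int j / of_nat N)))" for t
    unfolding S_def of_real_sum of_real_power circle_power_complex vertex_angle_def
    by (intro sum.cong) (simp_all add: algebra_simps)
  have "complex_of_real (S t) = of_real (S s)"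
    unfolding eq by (rule power_sum_cis_constant) (use assms in simp)
  hence "S t = S s" by (simp only: of_real_eq_iff)
  thus ?thesis by (simp only: S_def)
qed

end

theorem mainTheorem4:
  fixes N k :: nat and c p :: complex and R \<rho> :: real
  assumes "N \<ge> 3" and "R > 0" and "\<rho> > 0"
    and nondegenerate_conic: "dist p c \<noteq> R * cos (pi / of_nat N)"
    and "1 \<le> k" and "k \<le> N - 1"
  shows "(\<lambda>t. \<Sum>j\<in>{1..int N}. half_angle_tangent N c R p \<rho> t j ^ k)
           constant_on steiner_porism N c R p"
proof -
  interpret steiner_configuration N c p R \<rho>
    using assms by unfold_locales
  have "k < N" using assms by simp
  have "(\<Sum>j\<in>{1..int N}. half_angle_tangent N c R p \<rho> t j ^ k) =
      (m / (r * \<bar>m\<^sup>2 - (cmod q)\<^sup>2\<bar>)) ^ k * (\<Sum>j\<in>{1..int N}. circle_power (vertex_angle 0 j) ^ k)"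
    if "t \<in> steiner_porism N c R p" for t
    unfolding half_angle_tangent_eq[OF that] power_mult_distrib sum_distrib_left[symmetric]
    using circle_power_sum_constant[OF \<open>k < N\<close>, of t 0] by simp
  thus ?thesis unfolding constant_on_def by blast
qed

end
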